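(* Let $G$ be a finite group and let $g \in S(G,\mathrm{Aut}(G))$. Then: (1) if $g = 1$, then $$\mathrm{Pr}_g(G,\mathrm{Aut}(G)) \geq \frac{|L(G)|}{|G|} + \frac{|C_{\mathrm{Aut}(G)}(G)|\,(|G|-|L(G)|)}{|G||\mathrm{Aut}(G)|};$$ (2) if $g \neq 1$, then $$\mathrm{Pr}_g(G,\mathrm{Aut}(G)) \geq \frac{|L(G)||C_{\mathrm{Aut}(G)}(G)|}{|G||\mathrm{Aut}(G)|}.$$
   Context: For a finite group $G$ with automorphism group $\mathrm{Aut}(G)$, $x\in G$ and $\alpha\in\mathrm{Aut}(G)$, write $[x,\alpha] := x^{-1}\alpha(x)$. Let $S(G,\mathrm{Aut}(G)) := \{[x,\alpha] : x\in G,\ \alpha\in\mathrm{Aut}(G)\}$, $L(G) := \{x\in G : [x,\alpha]=1 \text{ for all } \alpha\in\mathrm{Aut}(G)\}$ and $C_{\mathrm{Aut}(G)}(G) := \{\alpha\in\mathrm{Aut}(G) : \alpha(x)=x \text{ for all } x\in G\}$. For $g \in G$, $$\mathrm{Pr}_g(G,\mathrm{Aut}(G)) := \frac{|\{(x,\alpha)\in G\times \mathrm{Aut}(G) : [x,\alpha]=g\}|}{|G||\mathrm{Aut}(G)|}.$$ *)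

theory Defs
  imports Complex_Main "HOL-Algebra.Bij" "HOL-Algebra.Coset"
begin

text \<open>
  The library's \<open>AutoGroup G\<close> consists of automorphisms that are extensional, i.e. equal to
  \<open>undefined\<close> outside \<open>carrier G\<close>. Each automorphism of \<open>G\<close> is thus a single HOL function, and
  cardinalities of sets of automorphisms are the intended ones.
\<close>

definition autocommutator :: "('a, 'b) monoid_scheme \<Rightarrow> 'a \<Rightarrow> ('a \<Rightarrow> 'a) \<Rightarrow> 'a"
  where "autocommutator G x \<alpha> = inv\<^bsub>G\<^esub> x \<otimes>\<^bsub>G\<^esub> \<alpha> x"

definition autocommutators :: "('a, 'b) monoid_scheme \<Rightarrow> 'a set"
  where "autocommutators G =
    {autocommutator G x \<alpha> | x \<alpha>. x \<in> carrier G \<and> \<alpha> \<in> carrier (AutoGroup G)}"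

definition absolute_centre :: "('a, 'b) monoid_scheme \<Rightarrow> 'a set"
  where "absolute_centre G =
    {x \<in> carrier G. \<forall>\<alpha> \<in> carrier (AutoGroup G). autocommutator G x \<alpha> = \<one>\<^bsub>G\<^esub>}"

definition aut_centralizer :: "('a, 'b) monoid_scheme \<Rightarrow> ('a \<Rightarrow> 'a) set"
  where "aut_centralizer G =
    {\<alpha> \<in> carrier (AutoGroup G). \<forall>x \<in> carrier G. \<alpha> x = x}"

definition autocommuting_prob :: "('a, 'b) monoid_scheme \<Rightarrow> 'a \<Rightarrow> real"
  where "autocommuting_prob G g =
    real (card {(x, \<alpha>) \<in> carrier G \<times> carrier (AutoGroup G). autocommutator G x \<alpha> = g}) /
    (real (order G) * real (order (AutoGroup G)))"

end

theory Submission
  imports Defs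
begin

text \<open>
  Both bounds come from exhibiting enough solutions \<open>(x, \<alpha>)\<close> of \<open>[x, \<alpha>] = g\<close>. For \<open>g = \<one>\<close> the
  equation says that \<open>\<alpha>\<close> fixes \<open>x\<close>: every automorphism fixes every element of \<open>L(G)\<close>, and the
  automorphisms that act trivially on \<open>G\<close> also fix all the elements outside \<open>L(G)\<close>; these two
  families of pairs are disjoint. For general \<open>g\<close>, fix one solution \<open>(y, \<alpha>)\<close>. Multiplying \<open>y\<close> on the
  left by an element \<open>z\<close> of \<open>L(G)\<close> gives another solution, because \<open>\<alpha> z = z\<close> and hence
  \<open>(z y)\<inverse> \<alpha>(z y) = y\<inverse> z\<inverse> z \<alpha>(y) = y\<inverse> \<alpha>(y)\<close>. This yields \<open>|L(G)|\<close> solutions, which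
  suffices because only the identity acts trivially on \<open>G\<close>.
\<close>

lemma auto_iff:
  "\<alpha> \<in> carrier (AutoGroup G) \<longleftrightarrow>
    \<alpha> \<in> hom G G \<and> \<alpha> \<in> extensional (carrier G) \<and> bij_betw \<alpha> (carrier G) (carrier G)"
  by (auto simp: AutoGroup_def auto_def Bij_def)

lemma finite_carrier_AutoGroup:
  assumes "finite (carrier G)"
  shows "finite (carrier (AutoGroup G))"
proof (rule finite_subset)
  show "carrier (AutoGroup G) \<subseteq> carrier G \<rightarrow>\<^sub>E carrier G"
    by (auto simp: auto_iff PiE_def hom_def)
  show "finite (carrier G \<rightarrow>\<^sub>E carrier G)"
    using assms by (simp add: finite_PiE)
qed

text \<open>
  An extensional function is determined by its values on the carrier, so the identity is the only
  automorphism that acts trivially.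
\<close>
lemma card_aut_centralizer_le_1: "card (aut_centralizer G) \<le> 1"
proof -
  have "aut_centralizer G \<subseteq> {restrict id (carrier G)}"
    by (auto simp: aut_centralizer_def auto_iff intro!: extensionalityI)
  from card_mono[OF _ this] show ?thesis by simp
qed

context group
begin

lemma autocommutator_eq_one_iff:
  assumes "x \<in> carrier G" and "\<alpha> \<in> carrier (AutoGroup G)"
  shows "autocommutator G x \<alpha> = \<one> \<longleftrightarrow> \<alpha> x = x"
proof -
  have "\<alpha> x \<in> carrier G"
    using assms by (auto simp: auto_iff hom_def)
  then show ?thesis
    using assms(1) inv_solve_left'[of \<one> x "\<alpha> x"] by (simp add: autocommutator_def)
qed

text \<open>
  Since every automorphism fixes \<open>z\<close>, the factors \<open>z\<inverse>\<close> and \<open>\<alpha> z = z\<close> of \<open>(z y)\<inverse> \<alpha>(z y)\<close>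
  meet in the middle and cancel.
\<close>
lemma autocommutator_absolute_centre_mult:
  assumes z: "z \<in> absolute_centre G" and y: "y \<in> carrier G" and \<alpha>: "\<alpha> \<in> carrier (AutoGroup G)"
  shows "autocommutator G (z \<otimes> y) \<alpha> = autocommutator G y \<alpha>"
proof -
  have zG: "z \<in> carrier G" and "\<alpha> z = z"
    using z \<alpha> autocommutator_eq_one_iff by (auto simp: absolute_centre_def)
  moreover have \<alpha>y: "\<alpha> y \<in> carrier G" and "\<alpha> (z \<otimes> y) = \<alpha> z \<otimes> \<alpha> y"
    using \<alpha> y zG by (auto simp: auto_iff hom_def)
  ultimately have "autocommutator G (z \<otimes> y) \<alpha> = inv y \<otimes> (inv z \<otimes> (z \<otimes> \<alpha> y))"
    using y by (simp add: autocommutator_def inv_mult_group m_assoc)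
  also have "inv z \<otimes> (z \<otimes> \<alpha> y) = \<alpha> y"
    using zG \<alpha>y by (simp add: m_assoc[symmetric])
  finally show ?thesis
    by (simp add: autocommutator_def)
qed

text \<open>
  The two summands count disjoint families of pairs with \<open>\<alpha> x = x\<close>: those with \<open>x\<close> in \<open>L(G)\<close> and
  \<open>\<alpha>\<close> arbitrary, and those with \<open>x\<close> outside \<open>L(G)\<close> and \<open>\<alpha>\<close> acting trivially.
\<close>
lemma card_autocommuting_pairs_ge:
  assumes fin: "finite (carrier G)"
  shows "card (absolute_centre G) * order (AutoGroup G)
      + (order G - card (absolute_centre G)) * card (aut_centralizer G)
    \<le> card {(x, \<alpha>) \<in> carrier G \<times> carrier (AutoGroup G). autocommutator G x \<alpha> = \<one>}"
    (is "_ \<le> card ?S")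
proof -
  let ?L = "absolute_centre G" and ?A = "carrier (AutoGroup G)" and ?C = "aut_centralizer G"
  have L: "?L \<subseteq> carrier G" and C: "?C \<subseteq> ?A"
    by (auto simp: absolute_centre_def aut_centralizer_def)
  have finA: "finite ?A" and finL: "finite ?L"
    using finite_carrier_AutoGroup[OF fin] finite_subset[OF L fin] by auto
  have "?L \<times> ?A \<union> (carrier G - ?L) \<times> ?C \<subseteq> ?S"
    using autocommutator_eq_one_iff by (auto simp: absolute_centre_def aut_centralizer_def)
  moreover have "finite ?S"
    using fin finA by (auto intro: finite_subset[of _ "carrier G \<times> ?A"])
  ultimately have "card (?L \<times> ?A \<union> (carrier G - ?L) \<times> ?C) \<le> card ?S"
    by (rule card_mono[rotated])
  moreover have "card (?L \<times> ?A \<union> (carrier G - ?L) \<times> ?C)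
      = card (?L \<times> ?A) + card ((carrier G - ?L) \<times> ?C)"
    using fin finA finL finite_subset[OF C finA] by (intro card_Un_disjoint) auto
  ultimately show ?thesis
    by (simp add: card_cartesian_product order_def card_Diff_subset[OF finL L])
qed

text \<open>
  One solution \<open>(y, \<alpha>)\<close> gives the solutions \<open>(z y, \<alpha>)\<close> with \<open>z\<close> in \<open>L(G)\<close>, which are distinct by
  cancellation of \<open>y\<close>.
\<close>
lemma card_autocommutator_pairs_ge:
  assumes fin: "finite (carrier G)" and g: "g \<in> autocommutators G"
  shows "card (absolute_centre G)
    \<le> card {(x, \<alpha>) \<in> carrier G \<times> carrier (AutoGroup G). autocommutator G x \<alpha> = g}"
    (is "_ \<le> card ?S")
proof -
  obtain y \<alpha> where y: "y \<in> carrier G" and \<alpha>: "\<alpha> \<in> carrier (AutoGroup G)"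
    and g_eq: "autocommutator G y \<alpha> = g"
    using g by (auto simp: autocommutators_def)
  let ?f = "\<lambda>z. (z \<otimes> y, \<alpha>)"
  have L: "absolute_centre G \<subseteq> carrier G"
    by (auto simp: absolute_centre_def)
  have "inj_on ?f (absolute_centre G)"
    using L y by (auto intro!: inj_onI simp: subset_iff)
  moreover have "?f ` absolute_centre G \<subseteq> ?S"
    using L y \<alpha> g_eq autocommutator_absolute_centre_mult by auto
  moreover have "finite ?S"
    using fin finite_carrier_AutoGroup[OF fin]
    by (auto intro: finite_subset[of _ "carrier G \<times> carrier (AutoGroup G)"])
  ultimately show ?thesis
    by (rule card_inj_on_le)
qed

end

theorem proposition3p1:
  fixes G :: "('a, 'b) monoid_scheme" and g :: 'a
  assumes "group G" and "finite (carrier G)" and "g \<in> autocommutators G"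
  shows "(g = \<one>\<^bsub>G\<^esub> \<longrightarrow>
      autocommuting_prob G g \<ge>
        real (card (absolute_centre G)) / real (order G) +
        real (card (aut_centralizer G)) * (real (order G) - real (card (absolute_centre G))) /
          (real (order G) * real (order (AutoGroup G)))) \<and>
    (g \<noteq> \<one>\<^bsub>G\<^esub> \<longrightarrow>
      autocommuting_prob G g \<ge>
        real (card (absolute_centre G)) * real (card (aut_centralizer G)) /
          (real (order G) * real (order (AutoGroup G))))"
proof -
  interpret group G by fact
  let ?L = "absolute_centre G" and ?C = "aut_centralizer G"
  let ?S = "{(x, \<alpha>) \<in> carrier G \<times> carrier (AutoGroup G). autocommutator G x \<alpha> = g}"
  have fin: "finite (carrier G)" by fact
  have pos: "real (order G) > 0" "real (order (AutoGroup G)) > 0"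
    using fin finite_carrier_AutoGroup[OF fin] order_gt_0_iff_finite
      monoid.order_gt_0_iff_finite[OF group.is_monoid[OF AutoGroup]] by auto
  have le: "card ?L \<le> order G"
    unfolding order_def using fin by (intro card_mono) (auto simp: absolute_centre_def)
  show ?thesis
  proof (intro conjI impI)
    assume "g = \<one>\<^bsub>G\<^esub>"
    then have "card ?L * order (AutoGroup G) + (order G - card ?L) * card ?C \<le> card ?S"
      using card_autocommuting_pairs_ge[OF fin] by simp
    then have "real (card ?L * order (AutoGroup G) + (order G - card ?L) * card ?C) \<le> real (card ?S)"
      by (rule of_nat_mono)
    then have "real (card ?L) * real (order (AutoGroup G))
        + (real (order G) - real (card ?L)) * real (card ?C) \<le> real (card ?S)"
      using le by (simp add: of_nat_diff)
    then have "(real (card ?L) * real (order (AutoGroup G))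
        + (real (order G) - real (card ?L)) * real (card ?C))
          / (real (order G) * real (order (AutoGroup G))) \<le> autocommuting_prob G g"
      unfolding autocommuting_prob_def by (intro divide_right_mono) auto
    then show "autocommuting_prob G g \<ge> real (card ?L) / real (order G) +
        real (card ?C) * (real (order G) - real (card ?L)) /
          (real (order G) * real (order (AutoGroup G)))"
      using pos by (simp add: add_divide_distrib mult.commute)
  next
    (* The factor for trivially acting automorphisms is at most 1, so varying x alone is enough. *)
    have "card ?L * card ?C \<le> card ?L * 1"
      using card_aut_centralizer_le_1 by (rule mult_le_mono2)
    also have "\<dots> \<le> card ?S"
      using card_autocommutator_pairs_ge[OF fin] assms(3) by simp
    finally have "real (card ?L * card ?C) \<le> real (card ?S)"
      by (rule of_nat_mono)
    then show "autocommuting_prob G g \<ge> real (card ?L) * real (card ?C) /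
        (real (order G) * real (order (AutoGroup G)))"
      unfolding autocommuting_prob_def by (intro divide_right_mono) auto
  qed
qed

end
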